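(* Let $d\ge2$ and let $\mathcal{E}_h$ and $\mathcal{E}$ be any two quantum channels on $\mathbb{C}^{d\times d}$ with $u(\mathcal{E})>0$. Then $$\left|p(\mathcal{E}_h)-\frac{p(\mathcal{E}_h\mathcal{E})\,p(\mathcal{E})}{u(\mathcal{E})}\right|\leq \sqrt{1-\frac{p(\mathcal{E})^2}{u(\mathcal{E})}}\sqrt{1-\frac{p(\mathcal{E}_h\mathcal{E})^2}{u(\mathcal{E})}}.$$
   Context: A quantum channel on $\mathbb{C}^{d\times d}$ is a completely positive trace-preserving linear map $\mathcal{E}:\mathbb{C}^{d\times d}\to\mathbb{C}^{d\times d}$. Composition is written $\mathcal{A}\mathcal{B}(\rho)=\mathcal{A}[\mathcal{B}(\rho)]$. Fix a Hermitian trace-orthonormal basis $B_0=\mathbb{I}_d/\sqrt d,B_1,\ldots,B_{d^2-1}$ of $\mathbb{C}^{d\times d}$ ($\mathrm{Tr}\,B_j^\dagger B_k=\delta_{jk}$). The Liouville representation of $\mathcal{E}$ is the matrix with entries $\mathrm{Tr}(B_j^\dagger\mathcal{E}(B_k))$, $0\le j,k\le d^2-1$; it has block form $\begin{pmatrix}1&0\\ \boldsymbol{\mathcal{E}}_{\rm n}&\boldsymbol{\mathcal{E}}_{\rm u}\end{pmatrix}$, where the $(d^2-1)\times(d^2-1)$ matrix $\boldsymbol{\mathcal{E}}_{\rm u}$ is the unital block. The effective depolarizing constant and the unitarity are $$p(\mathcal{E})=\frac{\mathrm{Tr}\,\boldsymbol{\mathcal{E}}_{\rm u}}{d^2-1},\qquad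 u(\mathcal{E})=\frac{\mathrm{Tr}\,\boldsymbol{\mathcal{E}}_{\rm u}^\dagger\boldsymbol{\mathcal{E}}_{\rm u}}{d^2-1}=\frac{\|\boldsymbol{\mathcal{E}}_{\rm u}\|_F^2}{d^2-1}$$ (these do not depend on the choice of basis). *)

theory Defs
  imports "Jordan_Normal_Form.Schur_Decomposition"
begin

definition mat_trace :: "complex mat \<Rightarrow> complex" where
  "mat_trace A = (\<Sum>i<dim_row A. A $$ (i, i))"

definition hermitian_mat :: "complex mat \<Rightarrow> bool" where
  "hermitian_mat A \<longleftrightarrow> mat_adjoint A = A"

definition psd_mat :: "nat \<Rightarrow> complex mat \<Rightarrow> bool" where
  "psd_mat n A \<longleftrightarrow> A \<in> carrier_mat n n \<and> hermitian_mat A \<and>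
     (\<forall>v \<in> carrier_vec n. 0 \<le> Re ((A *\<^sub>v v) \<bullet>c v))"

text \<open>A linear map on the \<open>d \<times> d\<close> matrices is a function on \<^typ>\<open>complex mat\<close>
  of which only the values on \<open>carrier_mat d d\<close> matter.\<close>

definition linear_map_mat :: "nat \<Rightarrow> (complex mat \<Rightarrow> complex mat) \<Rightarrow> bool" where
  "linear_map_mat d E \<longleftrightarrow>
     (\<forall>X \<in> carrier_mat d d. E X \<in> carrier_mat d d) \<and>
     (\<forall>X \<in> carrier_mat d d. \<forall>Y \<in> carrier_mat d d. E (X + Y) = E X + E Y) \<and>
     (\<forall>c. \<forall>X \<in> carrier_mat d d. E (c \<cdot>\<^sub>m X) = c \<cdot>\<^sub>m E X)"

definition trace_preserving :: "nat \<Rightarrow> (complex mat \<Rightarrow> complex mat) \<Rightarrow> bool" where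
  "trace_preserving d E \<longleftrightarrow> (\<forall>X \<in> carrier_mat d d. mat_trace (E X) = mat_trace X)"

definition mat_block :: "nat \<Rightarrow> complex mat \<Rightarrow> nat \<Rightarrow> nat \<Rightarrow> complex mat" where
  "mat_block d X a b = mat d d (\<lambda>(i, j). X $$ (a * d + i, b * d + j))"

text \<open>The map \<open>id \<otimes> E\<close> on \<open>n \<times> n\<close> block matrices with blocks of size \<open>d \<times> d\<close>:
  \<open>E\<close> is applied to each block.\<close>

definition ampliation ::
    "nat \<Rightarrow> nat \<Rightarrow> (complex mat \<Rightarrow> complex mat) \<Rightarrow> complex mat \<Rightarrow> complex mat" where
  "ampliation n d E X =
     mat (n * d) (n * d)
       (\<lambda>(r, s). E (mat_block d X (r div d) (s div d)) $$ (r mod d, s mod d))"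

definition completely_positive :: "nat \<Rightarrow> (complex mat \<Rightarrow> complex mat) \<Rightarrow> bool" where
  "completely_positive d E \<longleftrightarrow>
     (\<forall>n X. psd_mat (n * d) X \<longrightarrow> psd_mat (n * d) (ampliation n d E X))"

definition quantum_channel :: "nat \<Rightarrow> (complex mat \<Rightarrow> complex mat) \<Rightarrow> bool" where
  "quantum_channel d E \<longleftrightarrow>
     linear_map_mat d E \<and> completely_positive d E \<and> trace_preserving d E"

definition hermitian_orthonormal_basis :: "nat \<Rightarrow> (nat \<Rightarrow> complex mat) \<Rightarrow> bool" where
  "hermitian_orthonormal_basis d B \<longleftrightarrow>
     (\<forall>k < d\<^sup>2. B k \<in> carrier_mat d d \<and> hermitian_mat (B k)) \<and>
     B 0 = complex_of_real (1 / sqrt (real d)) \<cdot>\<^sub>m 1\<^sub>m d \<and>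
     (\<forall>j < d\<^sup>2. \<forall>k < d\<^sup>2. mat_trace (mat_adjoint (B j) * B k) = (if j = k then 1 else 0)) \<and>
     (\<forall>X \<in> carrier_mat d d. \<exists>c. X = mat d d (\<lambda>(r, s). \<Sum>k < d\<^sup>2. c k * B k $$ (r, s)))"

definition liouville ::
    "nat \<Rightarrow> (nat \<Rightarrow> complex mat) \<Rightarrow> (complex mat \<Rightarrow> complex mat) \<Rightarrow> complex mat" where
  "liouville d B E = mat (d\<^sup>2) (d\<^sup>2) (\<lambda>(j, k). mat_trace (mat_adjoint (B j) * E (B k)))"

definition unital_block ::
    "nat \<Rightarrow> (nat \<Rightarrow> complex mat) \<Rightarrow> (complex mat \<Rightarrow> complex mat) \<Rightarrow> complex mat" where
  "unital_block d B E =
     mat (d\<^sup>2 - 1) (d\<^sup>2 - 1) (\<lambda>(j, k). liouville d B E $$ (Suc j, Suc k))"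

text \<open>Both traces below are real, so taking \<^const>\<open>Re\<close> only changes the type; for the first one,
  which needs \<open>E\<close> to be a channel, this is the lemma \<open>trace_unital_block_real\<close>.\<close>

definition depol_const ::
    "nat \<Rightarrow> (nat \<Rightarrow> complex mat) \<Rightarrow> (complex mat \<Rightarrow> complex mat) \<Rightarrow> real" where
  "depol_const d B E = Re (mat_trace (unital_block d B E)) / (real d ^ 2 - 1)"

definition unitarity ::
    "nat \<Rightarrow> (nat \<Rightarrow> complex mat) \<Rightarrow> (complex mat \<Rightarrow> complex mat) \<Rightarrow> real" where
  "unitarity d B E =
     Re (mat_trace (mat_adjoint (unital_block d B E) * unital_block d B E)) / (real d ^ 2 - 1)"

lemma mat_adjoint_index:
  "i < dim_col A \<Longrightarrow> j < dim_row A \<Longrightarrow> mat_adjoint A $$ (i, j) = cnj (A $$ (j, i))"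
  by (simp add: mat_adjoint_def mat_of_rows_index)

lemma mat_adjoint_carrier: "A \<in> carrier_mat n m \<Longrightarrow> mat_adjoint A \<in> carrier_mat m n"
  by (auto simp: mat_adjoint_def)

lemma hermitian_matI:
  assumes A: "A \<in> carrier_mat n n" and h: "\<And>i j. i < n \<Longrightarrow> j < n \<Longrightarrow> A $$ (j, i) = cnj (A $$ (i, j))"
  shows "hermitian_mat A"
  unfolding hermitian_mat_def
proof (rule eq_matI)
  show "dim_row (mat_adjoint A) = dim_row A" "dim_col (mat_adjoint A) = dim_col A"
    using A mat_adjoint_carrier[OF A] by auto
  show "mat_adjoint A $$ (i, j) = A $$ (i, j)" if "i < dim_row A" "j < dim_col A" for i j
    using that A h[of j i] by (simp add: mat_adjoint_index)
qed

lemma hermitian_matD: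
  assumes "hermitian_mat A" "A \<in> carrier_mat n n" "i < n" "j < n"
  shows "A $$ (j, i) = cnj (A $$ (i, j))"
  using mat_adjoint_index[of j A i] assms by (simp add: hermitian_mat_def)

lemma trace_mult_hermitian_real:
  assumes A: "A \<in> carrier_mat n n" "hermitian_mat A" and B: "B \<in> carrier_mat n n" "hermitian_mat B"
  shows "Im (mat_trace (A * B)) = 0"
proof -
  have t: "mat_trace (A * B) = (\<Sum>i<n. \<Sum>j<n. A $$ (i, j) * B $$ (j, i))"
    using A B unfolding mat_trace_def
    by (auto simp: scalar_prod_def atLeast0LessThan intro!: sum.cong)
  have "cnj (mat_trace (A * B)) = (\<Sum>i<n. \<Sum>j<n. cnj (A $$ (i, j)) * cnj (B $$ (j, i)))"
    unfolding t by simp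
  also have "\<dots> = (\<Sum>i<n. \<Sum>j<n. A $$ (j, i) * B $$ (i, j))"
  proof (intro sum.cong refl)
    fix i j assume "i \<in> {..<n}" "j \<in> {..<n}"
    then show "cnj (A $$ (i, j)) * cnj (B $$ (j, i)) = A $$ (j, i) * B $$ (i, j)"
      using hermitian_matD[OF A(2,1), of i j] hermitian_matD[OF B(2,1), of j i] by simp
  qed
  also have "\<dots> = mat_trace (A * B)"
    unfolding t by (rule sum.swap)
  finally show ?thesis by (simp add: complex_eq_iff)
qed

lemma quadratic_form:
  assumes "A \<in> carrier_mat n n" "v \<in> carrier_vec n"
  shows "(A *\<^sub>v v) \<bullet>c v = (\<Sum>i<n. \<Sum>j<n. A $$ (i, j) * v $ j * cnj (v $ i))"
  using assms
  by (auto simp: scalar_prod_def sum_distrib_right atLeast0LessThan intro!: sum.cong)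

lemma hermitian_shift_psd:
  assumes A: "A \<in> carrier_mat n n" "hermitian_mat A"
  defines "c \<equiv> (\<Sum>i<n. \<Sum>j<n. cmod (A $$ (i, j)))"
  shows "psd_mat n (A + complex_of_real c \<cdot>\<^sub>m 1\<^sub>m n)"
  unfolding psd_mat_def
proof (intro conjI ballI)
  let ?S = "A + complex_of_real c \<cdot>\<^sub>m 1\<^sub>m n"
  show S: "?S \<in> carrier_mat n n" using A by auto
  show "hermitian_mat ?S"
  proof (rule hermitian_matI[OF S])
    fix i j assume "i < n" "j < n"
    then show "?S $$ (j, i) = cnj (?S $$ (i, j))"
      using A hermitian_matD[OF A(2,1), of i j] by simp
  qed
  fix v :: "complex vec" assume v: "v \<in> carrier_vec n"
  define q where "q = (\<Sum>k<n. (cmod (v $ k))\<^sup>2)"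
  have le: "cmod (v $ i) * cmod (v $ j) \<le> q" if "i < n" "j < n" for i j
  proof -
    have "(cmod (v $ k))\<^sup>2 \<le> q" if "k < n" for k
      unfolding q_def using that by (intro member_le_sum) auto
    from this[OF that(1)] this[OF that(2)] show ?thesis
      using sum_squares_bound[of "cmod (v $ i)" "cmod (v $ j)"] by linarith
  qed
  have "cmod ((A *\<^sub>v v) \<bullet>c v) \<le> (\<Sum>i<n. \<Sum>j<n. cmod (A $$ (i, j)) * q)"
    unfolding quadratic_form[OF A(1) v]
  proof (intro sum_norm_le)
    fix i j assume ij: "i \<in> {..<n}" "j \<in> {..<n}"
    show "cmod (A $$ (i, j) * v $ j * cnj (v $ i)) \<le> cmod (A $$ (i, j)) * q"
      using mult_left_mono[OF le, of j i "cmod (A $$ (i, j))"] ij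
      by (simp add: norm_mult mult.assoc)
  qed
  also have "\<dots> = c * q" by (simp add: c_def sum_distrib_right)
  finally have "Re ((A *\<^sub>v v) \<bullet>c v) \<ge> - (c * q)"
    using abs_Re_le_cmod[of "(A *\<^sub>v v) \<bullet>c v"] by linarith
  moreover have "(?S *\<^sub>v v) \<bullet>c v = (A *\<^sub>v v) \<bullet>c v + complex_of_real (c * q)"
  proof -
    have "(?S *\<^sub>v v) \<bullet>c v = (\<Sum>i<n. \<Sum>j<n. A $$ (i, j) * v $ j * cnj (v $ i)
        + (if i = j then complex_of_real c * (v $ j * cnj (v $ i)) else 0))"
      unfolding quadratic_form[OF S v] using A
      by (intro sum.cong refl) (auto simp: algebra_simps)
    also have "\<dots> = (A *\<^sub>v v) \<bullet>c v + (\<Sum>i<n. complex_of_real c * (v $ i * cnj (v $ i)))"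
      unfolding quadratic_form[OF A(1) v] by (simp add: sum.distrib)
    also have "(\<Sum>i<n. complex_of_real c * (v $ i * cnj (v $ i))) = complex_of_real (c * q)"
      unfolding q_def of_real_mult of_real_sum complex_norm_square sum_distrib_left ..
    finally show ?thesis .
  qed
  ultimately show "0 \<le> Re ((?S *\<^sub>v v) \<bullet>c v)" by simp
qed

lemma channel_psd:
  assumes E: "quantum_channel d E" and X: "psd_mat d X"
  shows "psd_mat d (E X)"
proof -
  have Xc: "X \<in> carrier_mat d d" using X by (simp add: psd_mat_def)
  hence EXc: "E X \<in> carrier_mat d d"
    using E by (simp add: quantum_channel_def linear_map_mat_def)
  have "mat_block d X 0 0 = X" using Xc by (auto simp: mat_block_def)
  hence "ampliation 1 d E X = E X"
    using EXc by (auto simp: ampliation_def)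
  moreover have "psd_mat (1 * d) (ampliation 1 d E X)"
    using E X unfolding quantum_channel_def completely_positive_def
    by (metis mult_1)
  ultimately show ?thesis by simp
qed

lemma channel_hermitian:
  assumes E: "quantum_channel d E" and X: "X \<in> carrier_mat d d" "hermitian_mat X"
  shows "hermitian_mat (E X)"
proof -
  obtain c where c: "psd_mat d (X + complex_of_real c \<cdot>\<^sub>m 1\<^sub>m d)" (is "psd_mat d ?S")
    using hermitian_shift_psd[OF X] by blast
  have one: "psd_mat d (1\<^sub>m d)"
    unfolding psd_mat_def
    by (auto intro!: hermitian_matI simp: scalar_prod_def sum_nonneg)
  have "E ?S = E X + complex_of_real c \<cdot>\<^sub>m E (1\<^sub>m d)"
    using E X by (simp add: quantum_channel_def linear_map_mat_def)
  moreover have car: "E X \<in> carrier_mat d d" "E (1\<^sub>m d) \<in> carrier_mat d d"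
    using E X by (simp_all add: quantum_channel_def linear_map_mat_def)
  ultimately have eq: "E X $$ (i, j) = E ?S $$ (i, j) - complex_of_real c * E (1\<^sub>m d) $$ (i, j)"
    if "i < d" "j < d" for i j using that by simp
  have "psd_mat d (E ?S)" "psd_mat d (E (1\<^sub>m d))"
    using channel_psd[OF E] c one by auto
  then have herm: "hermitian_mat (E ?S)" "hermitian_mat (E (1\<^sub>m d))"
    and carS: "E ?S \<in> carrier_mat d d"
    by (auto simp: psd_mat_def)
  note h = hermitian_matD[OF herm(1) carS] hermitian_matD[OF herm(2) car(2)]
  show ?thesis
  proof (rule hermitian_matI[OF car(1)])
    fix i j assume ij: "i < d" "j < d"
    show "E X $$ (j, i) = cnj (E X $$ (i, j))"
      unfolding eq[OF ij] eq[OF ij(2,1)] h[OF ij] by simp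
  qed
qed

lemma trace_unital_block_real:
  assumes B: "hermitian_orthonormal_basis d B" and E: "quantum_channel d E"
  shows "Im (mat_trace (unital_block d B E)) = 0"
proof -
  have "Im (liouville d B E $$ (k, k)) = 0" if k: "k < d\<^sup>2" for k
  proof -
    have b: "B k \<in> carrier_mat d d" "hermitian_mat (B k)"
      using B k by (auto simp: hermitian_orthonormal_basis_def)
    have "E (B k) \<in> carrier_mat d d"
      using E b by (simp add: quantum_channel_def linear_map_mat_def)
    from trace_mult_hermitian_real[OF b this channel_hermitian[OF E b]] k b(2)
    show ?thesis by (simp add: liouville_def hermitian_mat_def)
  qed
  thus ?thesis by (simp add: mat_trace_def unital_block_def)
qed

end

theory Submission
  imports Defs "HOL-Analysis.Convex"
begin

text \<open>For the inner product \<open>\<langle>X, Y\<rangle> = Tr X\<^sup>T Y / (d\<^sup>2 - 1)\<close> on real matrices, with \<open>M\<close> and \<open>H\<close> the unital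
  blocks of \<open>E\<close> and \<open>E\<^sub>h\<close>, one has \<open>p(E) = \<langle>1, M\<rangle>\<close>, \<open>u(E) = \<langle>M, M\<rangle>\<close>, \<open>p(E\<^sub>h) = \<langle>1, H\<^sup>T\<rangle>\<close> and, since
  trace preservation makes Liouville matrices block triangular, \<open>p(E\<^sub>h E) = \<langle>H\<^sup>T, M\<rangle>\<close>. The claim is
  Cauchy--Schwarz for the components of \<open>1\<close> and \<open>H\<^sup>T\<close> orthogonal to \<open>M\<close>, once \<open>u(E\<^sub>h) \<le> 1\<close> is known.
  For the latter, Bessel's inequality bounds the squared Frobenius norm of the Liouville matrix by
  that of the Choi matrix \<open>J\<close>; as \<open>J\<close> is positive semidefinite, its \<open>2 \<times> 2\<close> minors give
  \<open>\<bar>J\<^sub>a\<^sub>b\<bar>\<^sup>2 \<le> J\<^sub>a\<^sub>a J\<^sub>b\<^sub>b\<close>, and summing yields \<open>(Tr J)\<^sup>2 = d\<^sup>2\<close>. The corner entry \<open>1\<close> of the Liouville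
  matrix accounts for the remaining \<open>- 1\<close>.\<close>

section \<open>Traces of products and minors of positive semidefinite matrices\<close>

lemma mat_trace_mult:
  assumes "A \<in> carrier_mat n m" "B \<in> carrier_mat m n"
  shows "mat_trace (A * B) = (\<Sum>i<n. \<Sum>j<m. A $$ (i, j) * B $$ (j, i))"
  using assms unfolding mat_trace_def
  by (auto simp: scalar_prod_def atLeast0LessThan intro!: sum.cong)

text \<open>A single sum over index pairs treats matrices as vectors, which is the form in which
  Bessel's inequality is applied later.\<close>

lemma mat_trace_adjoint_mult:
  assumes "A \<in> carrier_mat n m" "B \<in> carrier_mat n m"
  shows "mat_trace (mat_adjoint A * B) = (\<Sum>(i, j)\<in>{..<n} \<times> {..<m}. cnj (A $$ (i, j)) * B $$ (i, j))"
proof -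
  have "mat_trace (mat_adjoint A * B) = (\<Sum>j<m. \<Sum>i<n. cnj (A $$ (i, j)) * B $$ (i, j))"
    unfolding mat_trace_mult[OF mat_adjoint_carrier[OF assms(1)] assms(2)]
    using assms by (auto simp: mat_adjoint_index intro!: sum.cong)
  also have "\<dots> = (\<Sum>i<n. \<Sum>j<m. cnj (A $$ (i, j)) * B $$ (i, j))"
    by (rule sum.swap)
  finally show ?thesis by (simp add: sum.cartesian_product)
qed

lemma psd_mat_diag_nonneg:
  assumes A: "psd_mat n A" and i: "i < n"
  shows "0 \<le> Re (A $$ (i, i))" "Im (A $$ (i, i)) = 0"
proof -
  have Ac: "A \<in> carrier_mat n n" using A by (simp add: psd_mat_def)
  have "(A *\<^sub>v unit_vec n i) \<bullet>c unit_vec n i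
      = (\<Sum>k<n. \<Sum>j<n. if k = i then (if j = i then A $$ (i, i) else 0) else 0)"
    unfolding quadratic_form[OF Ac unit_vec_carrier] using i
    by (intro sum.cong refl) (auto simp: unit_vec_def)
  also have "\<dots> = (\<Sum>k<n. if k = i then A $$ (i, i) else 0)"
    using i by (intro sum.cong refl) auto
  also have "\<dots> = A $$ (i, i)" using i by simp
  finally show "0 \<le> Re (A $$ (i, i))"
    using A i by (metis psd_mat_def unit_vec_carrier)
  have "A $$ (i, i) = cnj (A $$ (i, i))"
    using hermitian_matD[of A n i i] A i by (simp add: psd_mat_def)
  then show "Im (A $$ (i, i)) = 0" by (simp add: complex_eq_iff)
qed

text \<open>Testing positivity on vectors supported on \<open>a\<close> and \<open>b\<close> gives
  an inequality between real numbers, and a suitable choice of the two weights yields the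
  minor.\<close>

lemma psd_mat_minor:
  assumes A: "psd_mat n A" and a: "a < n" and b: "b < n"
  shows "(cmod (A $$ (a, b)))\<^sup>2 \<le> Re (A $$ (a, a)) * Re (A $$ (b, b))"
proof (cases "a = b")
  case True
  then show ?thesis
    using psd_mat_diag_nonneg[OF A a] by (simp add: cmod_def power2_eq_square)
next
  case False
  have Ac: "A \<in> carrier_mat n n" using A by (simp add: psd_mat_def)
  define z \<alpha> \<beta> where "z = A $$ (a, b)" and "\<alpha> = Re (A $$ (a, a))" and "\<beta> = Re (A $$ (b, b))"
  have aa: "A $$ (a, a) = of_real \<alpha>" and bb: "A $$ (b, b) = of_real \<beta>"
    using psd_mat_diag_nonneg[OF A a] psd_mat_diag_nonneg[OF A b]
    by (auto simp: \<alpha>_def \<beta>_def complex_eq_iff)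
  have ba: "A $$ (b, a) = cnj z"
    using hermitian_matD[of A n a b] A a b by (simp add: psd_mat_def z_def)
  have two: "(\<Sum>i<n. g i * (if i = a then x else if i = b then y else 0)) = g a * x + g b * y"
    for g :: "nat \<Rightarrow> complex" and x y
  proof -
    have "(\<Sum>i<n. g i * (if i = a then x else if i = b then y else 0))
        = (\<Sum>i<n. (if i = a then g a * x else 0) + (if i = b then g b * y else 0))"
      using False by (intro sum.cong refl) auto
    then show ?thesis using a b by (simp add: sum.distrib)
  qed
  have form: "0 \<le> s\<^sup>2 * \<alpha> + t\<^sup>2 * (cmod z)\<^sup>2 * \<beta> - 2 * s * t * (cmod z)\<^sup>2" for s t :: real
  proof -
    \<comment> \<open>The phase of the entry at \<open>b\<close> is chosen so that the cross terms
      become real and negative for positive \<open>s\<close> and \<open>t\<close>. The function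
      \<open>?h\<close> is the conjugate of \<open>?f\<close>.\<close>
    let ?f = "\<lambda>i. if i = a then of_real s else if i = b then - of_real t * cnj z else (0::complex)"
    let ?h = "\<lambda>i. if i = a then of_real s else if i = b then - of_real t * z else (0::complex)"
    have "(A *\<^sub>v vec n ?f) \<bullet>c vec n ?f = (\<Sum>i<n. (\<Sum>j<n. A $$ (i, j) * ?f j) * ?h i)"
      unfolding quadratic_form[OF Ac vec_carrier] sum_distrib_right
      by (intro sum.cong refl) auto
    also have "\<dots> = (A $$ (a, a) * s - A $$ (a, b) * (t * cnj z)) * s
        - (A $$ (b, a) * s - A $$ (b, b) * (t * cnj z)) * (t * z)"
      unfolding two by simp
    also have "\<dots> = of_real (s\<^sup>2 * \<alpha> + t\<^sup>2 * (cmod z)\<^sup>2 * \<beta> - 2 * s * t * (cmod z)\<^sup>2)"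
      unfolding aa bb ba z_def[symmetric] of_real_add of_real_mult of_real_diff complex_norm_square
      by (simp add: complex_norm_square algebra_simps power2_eq_square)
    finally have "(A *\<^sub>v vec n ?f) \<bullet>c vec n ?f
        = of_real (s\<^sup>2 * \<alpha> + t\<^sup>2 * (cmod z)\<^sup>2 * \<beta> - 2 * s * t * (cmod z)\<^sup>2)" .
    moreover have "0 \<le> Re ((A *\<^sub>v vec n ?f) \<bullet>c vec n ?f)"
      using A vec_carrier[of n ?f] unfolding psd_mat_def by blast
    ultimately show ?thesis by simp
  qed
  have nn: "0 \<le> \<alpha>" "0 \<le> \<beta>"
    unfolding \<alpha>_def \<beta>_def using psd_mat_diag_nonneg(1)[OF A] a b by blast+
  show ?thesis unfolding z_def[symmetric] \<alpha>_def[symmetric] \<beta>_def[symmetric]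
  proof (cases "\<beta> = 0")
    case True
    show "(cmod z)\<^sup>2 \<le> \<alpha> * \<beta>"
    proof (rule ccontr)
      assume "\<not> (cmod z)\<^sup>2 \<le> \<alpha> * \<beta>"
      then have "(cmod z)\<^sup>2 > 0" using True by simp
      \<comment> \<open>With \<open>\<beta> = 0\<close> and \<open>s = 1\<close>, this
        \<open>t\<close> turns the form into \<open>- \<alpha> - 2\<close>, which is
        negative.\<close>
      then show False using form[of 1 "(\<alpha> + 1) / (cmod z)\<^sup>2"] True nn by simp
    qed
  next
    case False
    \<comment> \<open>The weights \<open>s = \<beta>\<close> and \<open>t = 1\<close> make the
      determinant of the minor appear as a factor.\<close>
    have "0 \<le> \<beta> * (\<alpha> * \<beta> - (cmod z)\<^sup>2)"
      using form[of \<beta> 1] by (simp add: algebra_simps power2_eq_square)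
    then show "(cmod z)\<^sup>2 \<le> \<alpha> * \<beta>" using False nn by (simp add: zero_le_mult_iff)
  qed
qed

section \<open>Bessel's inequality for finite sums\<close>

text \<open>The vector \<open>w\<close> is the orthogonal projection of \<open>y\<close> onto the
  span of the \<open>b k\<close>. The products of \<open>y\<close> with \<open>w\<close>, of
  \<open>w\<close> with \<open>y\<close> and of \<open>w\<close> with itself all equal
  \<open>?C\<close>, so the squared length of \<open>y - w\<close> is the difference of the two
  sides.\<close>

lemma bessel_inequality_sum:
  fixes b :: "nat \<Rightarrow> 'a \<Rightarrow> complex"
  assumes orth: "\<And>j k. j < n \<Longrightarrow> k < n \<Longrightarrow> (\<Sum>x\<in>I. cnj (b j x) * b k x) = (if j = k then 1 else 0)"
  shows "(\<Sum>k<n. (cmod (\<Sum>x\<in>I. cnj (b k x) * y x))\<^sup>2) \<le> (\<Sum>x\<in>I. (cmod (y x))\<^sup>2)"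
proof -
  define c where "c k = (\<Sum>x\<in>I. cnj (b k x) * y x)" for k
  define w where "w x = (\<Sum>k<n. c k * b k x)" for x
  let ?C = "\<Sum>k<n. c k * cnj (c k)"
  have yw: "(\<Sum>x\<in>I. y x * cnj (w x)) = ?C"
  proof -
    have "(\<Sum>x\<in>I. y x * cnj (w x)) = (\<Sum>x\<in>I. \<Sum>k<n. cnj (c k) * (cnj (b k x) * y x))"
      by (simp add: w_def sum_distrib_left mult_ac)
    also have "\<dots> = (\<Sum>k<n. \<Sum>x\<in>I. cnj (c k) * (cnj (b k x) * y x))" by (rule sum.swap)
    also have "\<dots> = ?C" 
      unfolding sum_distrib_left[symmetric] c_def[symmetric] by (simp add: mult.commute)
    finally show ?thesis .
  qed
  have wy: "(\<Sum>x\<in>I. w x * cnj (y x)) = ?C"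
    using arg_cong[OF yw, of cnj] by (simp add: mult_ac)
  have bw: "(\<Sum>x\<in>I. cnj (b k x) * w x) = c k" if "k < n" for k
  proof -
    have "(\<Sum>x\<in>I. cnj (b k x) * w x) = (\<Sum>x\<in>I. \<Sum>j<n. c j * (cnj (b k x) * b j x))"
      by (simp add: w_def sum_distrib_left mult_ac)
    also have "\<dots> = (\<Sum>j<n. \<Sum>x\<in>I. c j * (cnj (b k x) * b j x))" by (rule sum.swap)
    also have "\<dots> = (\<Sum>j<n. if j = k then c k else 0)"
      using that by (intro sum.cong refl) (auto simp: sum_distrib_left[symmetric] orth)
    finally show ?thesis using that by simp
  qed
  have ww: "(\<Sum>x\<in>I. w x * cnj (w x)) = ?C"
  proof -
    have "cnj (w x) = (\<Sum>k<n. cnj (c k) * cnj (b k x))" for x by (simp add: w_def)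
    then have "(\<Sum>x\<in>I. w x * cnj (w x)) = (\<Sum>x\<in>I. \<Sum>k<n. cnj (c k) * (cnj (b k x) * w x))"
      by (simp add: sum_distrib_left mult_ac)
    also have "\<dots> = (\<Sum>k<n. \<Sum>x\<in>I. cnj (c k) * (cnj (b k x) * w x))" by (rule sum.swap)
    also have "\<dots> = ?C"
      unfolding sum_distrib_left[symmetric]
      by (intro sum.cong refl) (subst bw, simp, rule mult.commute)
    finally show ?thesis .
  qed
  have "complex_of_real (\<Sum>x\<in>I. (cmod (y x - w x))\<^sup>2)
      = (\<Sum>x\<in>I. y x * cnj (y x)) - (\<Sum>x\<in>I. y x * cnj (w x))
        - (\<Sum>x\<in>I. w x * cnj (y x)) + (\<Sum>x\<in>I. w x * cnj (w x))"
    unfolding of_real_sum complex_norm_square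
    by (simp add: algebra_simps sum.distrib sum_subtractf)
  also have "\<dots> = (\<Sum>x\<in>I. y x * cnj (y x)) - ?C" unfolding yw wy ww by simp
  also have "\<dots> = complex_of_real ((\<Sum>x\<in>I. (cmod (y x))\<^sup>2) - (\<Sum>k<n. (cmod (c k))\<^sup>2))"
    unfolding of_real_diff of_real_sum complex_norm_square ..
  finally have "(\<Sum>x\<in>I. (cmod (y x - w x))\<^sup>2) = (\<Sum>x\<in>I. (cmod (y x))\<^sup>2) - (\<Sum>k<n. (cmod (c k))\<^sup>2)"
    by (simp only: of_real_eq_iff)
  moreover have "0 \<le> (\<Sum>x\<in>I. (cmod (y x - w x))\<^sup>2)" by (simp add: sum_nonneg)
  ultimately show ?thesis unfolding c_def by linarith
qed

section \<open>Linear maps, matrix units and the Choi matrix\<close>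

text \<open>The combination is formed entrywise, to match the spanning clause of
  \<open>hermitian_orthonormal_basis\<close>.\<close>

lemma linear_map_mat_sum:
  assumes E: "linear_map_mat d E" and S: "finite S"
    and F: "\<And>k. k \<in> S \<Longrightarrow> F k \<in> carrier_mat d d" and rs: "r < d" "s < d"
  shows "E (mat d d (\<lambda>(i, j). \<Sum>k\<in>S. c k * F k $$ (i, j))) $$ (r, s) = (\<Sum>k\<in>S. c k * E (F k) $$ (r, s))"
  using S F
proof (induction S rule: finite_induct)
  case empty
  \<comment> \<open>Written as \<open>0\<close> times itself, the zero matrix is sent to zero by
    homogeneity.\<close>
  have Z: "mat d d (\<lambda>(i, j). \<Sum>k\<in>{}. c k * F k $$ (i, j)) = 0 \<cdot>\<^sub>m 0\<^sub>m d d"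
    by (intro eq_matI) auto
  have z: "E (0 \<cdot>\<^sub>m 0\<^sub>m d d) = 0 \<cdot>\<^sub>m E (0\<^sub>m d d)" and "E (0\<^sub>m d d) \<in> carrier_mat d d"
    using E zero_carrier_mat[of d d] unfolding linear_map_mat_def by blast+
  then show ?case unfolding Z z using rs by simp
next
  case (insert x S)
  let ?M = "mat d d (\<lambda>(i, j). \<Sum>k\<in>S. c k * F k $$ (i, j))"
  have Fx: "F x \<in> carrier_mat d d" using insert by auto
  have ins: "mat d d (\<lambda>(i, j). \<Sum>k\<in>insert x S. c k * F k $$ (i, j)) = c x \<cdot>\<^sub>m F x + ?M"
    using insert(1,2) Fx by (intro eq_matI) auto
  have add: "E (c x \<cdot>\<^sub>m F x + ?M) = c x \<cdot>\<^sub>m E (F x) + E ?M"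
    using E Fx by (simp add: linear_map_mat_def)
  have "E (F x) \<in> carrier_mat d d" "E ?M \<in> carrier_mat d d"
    using E Fx by (auto simp: linear_map_mat_def)
  moreover have "E ?M $$ (r, s) = (\<Sum>k\<in>S. c k * E (F k) $$ (r, s))"
    using insert by blast
  ultimately show ?case unfolding ins add using insert(1,2) rs by simp
qed

definition elem_mat :: "nat \<Rightarrow> nat \<Rightarrow> nat \<Rightarrow> complex mat" where
  "elem_mat d a b = mat d d (\<lambda>(i, j). if i = a \<and> j = b then 1 else 0)"

lemma elem_mat_carrier [simp]: "elem_mat d a b \<in> carrier_mat d d"
  by (simp add: elem_mat_def)

lemma linear_map_mat_expand:
  assumes E: "linear_map_mat d E" and X: "X \<in> carrier_mat d d" and rs: "r < d" "s < d"
  shows "E X $$ (r, s) = (\<Sum>(i, j)\<in>{..<d} \<times> {..<d}. X $$ (i, j) * E (elem_mat d i j) $$ (r, s))"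
proof -
  let ?I = "{..<d} \<times> {..<d}" and ?F = "\<lambda>p. elem_mat d (fst p) (snd p)"
  have "X = mat d d (\<lambda>(i, j). \<Sum>p\<in>?I. X $$ p * ?F p $$ (i, j))" (is "X = ?M")
  proof (rule eq_matI)
    fix i j assume "i < dim_row ?M" "j < dim_col ?M"
    then have ij: "i < d" "j < d" by auto
    have "(\<Sum>p\<in>?I. X $$ p * ?F p $$ (i, j)) = (\<Sum>p\<in>?I. if p = (i, j) then X $$ (i, j) else 0)"
      using ij by (intro sum.cong refl) (auto simp: elem_mat_def)
    then show "X $$ (i, j) = ?M $$ (i, j)" using ij by simp
  qed (use X in auto)
  then have "E X $$ (r, s) = E ?M $$ (r, s)" by (rule arg_cong)
  also have "\<dots> = (\<Sum>p\<in>?I. X $$ p * E (?F p) $$ (r, s))"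
    by (rule linear_map_mat_sum[OF E]) (use rs in auto)
  finally show ?thesis by (simp add: case_prod_beta)
qed

text \<open>The argument of the ampliation is \<open>w w\<^sup>*\<close> for the unnormalised maximally entangled
  vector \<open>w\<close>, whose entry at \<open>a * d + i\<close> is \<open>1\<close> for \<open>a = i\<close> and \<open>0\<close> otherwise.\<close>

definition choi_mat :: "nat \<Rightarrow> (complex mat \<Rightarrow> complex mat) \<Rightarrow> complex mat" where
  "choi_mat d E = ampliation d d E
     (mat (d * d) (d * d) (\<lambda>(r, s). of_bool (r div d = r mod d) * of_bool (s div d = s mod d)))"

lemma index_lt_mult:
  fixes a i d :: nat
  assumes "a < d" "i < d"
  shows "a * d + i < d * d"
proof -
  have "a * d + i < (a + 1) * d" using assms by simp
  also have "\<dots> \<le> d * d" using assms by (intro mult_le_mono1) simp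
  finally show ?thesis .
qed

text \<open>Block \<open>(a, b)\<close> of the rank-one matrix inside \<open>choi_mat\<close> is a
  matrix unit, and the ampliation applies \<open>E\<close> to it.\<close>

lemma choi_mat_index:
  assumes "a < d" "b < d" "i < d" "j < d"
  shows "choi_mat d E $$ (a * d + i, b * d + j) = E (elem_mat d a b) $$ (i, j)"
proof -
  have "mat_block d (mat (d * d) (d * d)
          (\<lambda>(r, s). of_bool (r div d = r mod d) * of_bool (s div d = s mod d))) a b = elem_mat d a b"
    using assms index_lt_mult[of _ d] by (intro eq_matI) (auto simp: mat_block_def elem_mat_def)
  then show ?thesis
    using assms index_lt_mult[of _ d] by (simp add: choi_mat_def ampliation_def)
qed

lemma psd_mat_outer:
  "psd_mat n (mat n n (\<lambda>(r, s). w r * cnj (w s)))"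
  unfolding psd_mat_def
proof (intro conjI ballI)
  let ?A = "mat n n (\<lambda>(r, s). w r * cnj (w s))"
  show "?A \<in> carrier_mat n n" by simp
  then show "hermitian_mat ?A" by (rule hermitian_matI) simp
  fix v :: "complex vec" assume v: "v \<in> carrier_vec n"
  define c where "c = (\<Sum>i<n. w i * cnj (v $ i))"
  have "(?A *\<^sub>v v) \<bullet>c v = (\<Sum>i<n. \<Sum>j<n. (w i * cnj (v $ i)) * (cnj (w j) * v $ j))"
    unfolding quadratic_form[OF \<open>?A \<in> carrier_mat n n\<close> v]
    by (intro sum.cong refl) (simp add: mult_ac)
  also have "\<dots> = c * cnj c" by (simp add: c_def sum_product)
  also have "\<dots> = complex_of_real ((cmod c)\<^sup>2)" by (rule complex_norm_square[symmetric])
  finally show "0 \<le> Re ((?A *\<^sub>v v) \<bullet>c v)" by simp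
qed

text \<open>This is the easy direction of Choi's theorem: a rank-one projector, up to scaling, is
  positive semidefinite, and complete positivity is applied at level \<open>d\<close>.\<close>

lemma choi_mat_psd:
  assumes "completely_positive d E"
  shows "psd_mat (d * d) (choi_mat d E)"
proof -
  have cnj_of_bool: "cnj (of_bool P) = of_bool P" for P by (cases P) auto
  have "psd_mat (d * d) (mat (d * d) (d * d)
          (\<lambda>(r, s). of_bool (r div d = r mod d) * of_bool (s div d = s mod d)))"
    using psd_mat_outer[of "d * d" "\<lambda>r. of_bool (r div d = r mod d)"]
    unfolding cnj_of_bool .
  then show ?thesis
    using assms unfolding completely_positive_def choi_mat_def by blast
qed

text \<open>The left side is the squared Frobenius norm of the Choi matrix. The numbers
  \<open>g a i\<close> are its diagonal entries; bounding each term by the product of two of them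
  makes the sum factor into the square of the trace.\<close>

lemma channel_elem_mat_sum_le:
  assumes E: "quantum_channel d E"
  shows "(\<Sum>(i, j)\<in>{..<d} \<times> {..<d}. \<Sum>(a, b)\<in>{..<d} \<times> {..<d}. (cmod (E (elem_mat d a b) $$ (i, j)))\<^sup>2)
           \<le> (real d)\<^sup>2"
proof -
  have lin: "linear_map_mat d E" and cp: "completely_positive d E" and tp: "trace_preserving d E"
    using E by (auto simp: quantum_channel_def)
  define g where "g a i = Re (E (elem_mat d a a) $$ (i, i))" for a i
  have "(cmod (E (elem_mat d a b) $$ (i, j)))\<^sup>2 \<le> g a i * g b j"
    if "a < d" "b < d" "i < d" "j < d" for a b i j
    using psd_mat_minor[OF choi_mat_psd[OF cp], of "a * d + i" "b * d + j"] that
    by (simp add: choi_mat_index index_lt_mult g_def)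
  then have "(\<Sum>(i, j)\<in>{..<d} \<times> {..<d}. \<Sum>(a, b)\<in>{..<d} \<times> {..<d}. (cmod (E (elem_mat d a b) $$ (i, j)))\<^sup>2)
      \<le> (\<Sum>(i, j)\<in>{..<d} \<times> {..<d}. \<Sum>(a, b)\<in>{..<d} \<times> {..<d}. g a i * g b j)"
    by (auto simp: case_prod_beta intro!: sum_mono)
  also have "\<dots> = (\<Sum>(i, j)\<in>{..<d} \<times> {..<d}. (\<Sum>a<d. g a i) * (\<Sum>b<d. g b j))"
    by (simp only: sum_product[symmetric] sum.cartesian_product[symmetric])
  also have "\<dots> = (\<Sum>i<d. \<Sum>a<d. g a i) * (\<Sum>j<d. \<Sum>b<d. g b j)"
    by (simp only: sum_product[symmetric] sum.cartesian_product[symmetric])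
  \<comment> \<open>After the exchange, the inner sum is the trace of the image of a diagonal matrix
    unit, which trace preservation fixes at 1.\<close>
  also have "(\<Sum>i<d. \<Sum>a<d. g a i) = (\<Sum>a<d. \<Sum>i<d. g a i)" by (rule sum.swap)
  also have "\<dots> = (\<Sum>a<d. 1)"
  proof (intro sum.cong refl)
    fix a assume "a \<in> {..<d}"
    have "E (elem_mat d a a) \<in> carrier_mat d d" using lin by (simp add: linear_map_mat_def)
    then have "(\<Sum>i<d. g a i) = Re (mat_trace (E (elem_mat d a a)))"
      by (auto simp: g_def mat_trace_def)
    also have "\<dots> = Re (mat_trace (elem_mat d a a))"
      using tp by (simp add: trace_preserving_def)
    also have "\<dots> = 1"
      using \<open>a \<in> {..<d}\<close> by (simp add: mat_trace_def elem_mat_def)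
    finally show "(\<Sum>i<d. g a i) = 1" .
  qed
  finally show ?thesis by (simp add: power2_eq_square)
qed

text \<open>These facts reconcile the truncated subtraction in the size of the unital block with the
  real denominator in \<open>depol_const\<close> and \<open>unitarity\<close>.\<close>

lemma square_pred:
  assumes "2 \<le> (d::nat)"
  shows "d\<^sup>2 = Suc (d\<^sup>2 - 1)" "real (d\<^sup>2 - 1) = (real d)\<^sup>2 - 1" "0 < (real d)\<^sup>2 - 1"
proof -
  have "2 * 2 \<le> d * d" using assms by (intro mult_le_mono)
  then show "d\<^sup>2 = Suc (d\<^sup>2 - 1)" by (simp add: power2_eq_square)
  then show "real (d\<^sup>2 - 1) = (real d)\<^sup>2 - 1"
    by (metis add_diff_cancel_left' of_nat_Suc of_nat_power)
  have "2\<^sup>2 \<le> (real d)\<^sup>2" using assms by (intro power_mono) auto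
  then show "0 < (real d)\<^sup>2 - 1" by simp
qed

section \<open>The Liouville representation in a fixed basis\<close>

context
  fixes d :: nat and B :: "nat \<Rightarrow> complex mat"
  assumes d2: "2 \<le> d" and hob: "hermitian_orthonormal_basis d B"
begin

lemma basis_carrier: "k < d\<^sup>2 \<Longrightarrow> B k \<in> carrier_mat d d"
  and basis_hermitian: "k < d\<^sup>2 \<Longrightarrow> hermitian_mat (B k)"
  using hob by (auto simp: hermitian_orthonormal_basis_def)

lemma basis_zero: "B 0 = complex_of_real (1 / sqrt (real d)) \<cdot>\<^sub>m 1\<^sub>m d"
  using hob by (auto simp: hermitian_orthonormal_basis_def)

lemma basis_orthonormal:
  "j < d\<^sup>2 \<Longrightarrow> k < d\<^sup>2 \<Longrightarrow>
    (\<Sum>x\<in>{..<d} \<times> {..<d}. cnj (B j $$ x) * B k $$ x) = (if j = k then 1 else 0)"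
  using hob mat_trace_adjoint_mult[OF basis_carrier basis_carrier, of j k]
  by (auto simp: hermitian_orthonormal_basis_def case_prod_beta)

lemma liouville_index:
  assumes "linear_map_mat d E" "j < d\<^sup>2" "k < d\<^sup>2"
  shows "liouville d B E $$ (j, k) = (\<Sum>x\<in>{..<d} \<times> {..<d}. cnj (B j $$ x) * E (B k) $$ x)"
proof -
  have "E (B k) \<in> carrier_mat d d"
    using assms basis_carrier by (simp add: linear_map_mat_def)
  then show ?thesis
    using mat_trace_adjoint_mult[OF basis_carrier, of j "E (B k)"] assms
    by (simp add: liouville_def case_prod_beta)
qed

text \<open>A channel preserves Hermiticity, and the trace of a product of two Hermitian matrices is
  real.\<close>

lemma liouville_real:
  assumes E: "quantum_channel d E" and jk: "j < d\<^sup>2" "k < d\<^sup>2"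
  shows "Im (liouville d B E $$ (j, k)) = 0"
proof -
  have "E (B k) \<in> carrier_mat d d"
    using E basis_carrier[OF jk(2)] by (simp add: quantum_channel_def linear_map_mat_def)
  from trace_mult_hermitian_real[OF basis_carrier[OF jk(1)] basis_hermitian[OF jk(1)] this
      channel_hermitian[OF E basis_carrier[OF jk(2)] basis_hermitian[OF jk(2)]]]
  show ?thesis
    using jk basis_hermitian[OF jk(1)] by (simp add: liouville_def hermitian_mat_def)
qed

text \<open>Pairing with \<open>B 0\<close>, a multiple of the identity, only sees the trace. Since
  \<open>E\<close> preserves it, \<open>E (B k)\<close> may be replaced by \<open>B k\<close>, and
  orthonormality finishes.\<close>

lemma liouville_row_zero:
  assumes E: "quantum_channel d E" and k: "k < d\<^sup>2"
  shows "liouville d B E $$ (0, k) = (if k = 0 then 1 else 0)"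
proof -
  have lin: "linear_map_mat d E" and tp: "trace_preserving d E"
    using E by (auto simp: quantum_channel_def)
  have EBk: "E (B k) \<in> carrier_mat d d"
    using lin basis_carrier[OF k] by (simp add: linear_map_mat_def)
  have *: "mat_trace (mat_adjoint (B 0) * X) = complex_of_real (1 / sqrt (real d)) * mat_trace X"
    if X: "X \<in> carrier_mat d d" for X
  proof -
    have 0: "0 < d\<^sup>2" using d2 by simp
    have "mat_trace (mat_adjoint (B 0) * X) = mat_trace (B 0 * X)"
      using basis_hermitian[OF 0] by (simp add: hermitian_mat_def)
    also have "B 0 * X = complex_of_real (1 / sqrt (real d)) \<cdot>\<^sub>m X"
      unfolding basis_zero
      by (simp only: mult_smult_assoc_mat[OF one_carrier_mat X] left_mult_one_mat[OF X])
    also have "mat_trace \<dots> = complex_of_real (1 / sqrt (real d)) * mat_trace X"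
      using X unfolding mat_trace_def sum_distrib_left by (intro sum.cong) auto
    finally show ?thesis .
  qed
  have "liouville d B E $$ (0, k) = mat_trace (mat_adjoint (B 0) * E (B k))"
    using k d2 by (simp add: liouville_def)
  also have "\<dots> = mat_trace (mat_adjoint (B 0) * B k)"
    unfolding *[OF EBk] *[OF basis_carrier[OF k]]
    using tp basis_carrier[OF k] by (simp add: trace_preserving_def)
  also have "\<dots> = (if 0 = k then 1 else 0)"
  proof -
    have "\<forall>j<d\<^sup>2. \<forall>k<d\<^sup>2. mat_trace (mat_adjoint (B j) * B k) = (if j = k then 1 else 0)"
      using hob unfolding hermitian_orthonormal_basis_def by blast
    moreover have "0 < d\<^sup>2" using d2 by simp
    ultimately show ?thesis using k by blast
  qed
  finally show ?thesis by (cases "k = 0") auto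
qed

text \<open>The basis spans, so some coefficients exist; pairing with \<open>B j\<close> identifies
  them as column \<open>k\<close> of the Liouville matrix.\<close>

lemma liouville_expansion:
  assumes E: "linear_map_mat d E" and k: "k < d\<^sup>2"
  shows "E (B k) = mat d d (\<lambda>(r, s). \<Sum>m<d\<^sup>2. liouville d B E $$ (m, k) * B m $$ (r, s))"
proof -
  have EBk: "E (B k) \<in> carrier_mat d d"
    using E basis_carrier[OF k] by (simp add: linear_map_mat_def)
  then obtain c where c: "E (B k) = mat d d (\<lambda>(r, s). \<Sum>m<d\<^sup>2. c m * B m $$ (r, s))"
    using hob unfolding hermitian_orthonormal_basis_def by blast
  have "liouville d B E $$ (j, k) = c j" if j: "j < d\<^sup>2" for j
  proof -
    have "liouville d B E $$ (j, k) = (\<Sum>x\<in>{..<d} \<times> {..<d}. \<Sum>m<d\<^sup>2. c m * (cnj (B j $$ x) * B m $$ x))"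
      unfolding liouville_index[OF E j k] unfolding c
      by (intro sum.cong refl) (auto simp: sum_distrib_left mult_ac)
    also have "\<dots> = (\<Sum>m<d\<^sup>2. \<Sum>x\<in>{..<d} \<times> {..<d}. c m * (cnj (B j $$ x) * B m $$ x))"
      by (rule sum.swap)
    also have "\<dots> = (\<Sum>m<d\<^sup>2. if m = j then c j else 0)"
      using j by (intro sum.cong refl) (auto simp: sum_distrib_left[symmetric] basis_orthonormal)
    finally show ?thesis using j by simp
  qed
  then show ?thesis by (subst c) (intro eq_matI; auto)
qed

text \<open>Expanding \<open>E (B k)\<close> in the basis before applying \<open>F\<close> turns
  composition into matrix multiplication.\<close>

lemma liouville_comp:
  assumes F: "linear_map_mat d F" and E: "linear_map_mat d E" and jk: "j < d\<^sup>2" "k < d\<^sup>2"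
  shows "liouville d B (F \<circ> E) $$ (j, k)
    = (\<Sum>m<d\<^sup>2. liouville d B F $$ (j, m) * liouville d B E $$ (m, k))"
proof -
  have FE: "linear_map_mat d (F \<circ> E)" using F E by (auto simp: linear_map_mat_def)
  let ?L = "liouville d B E"
  have FEx: "(F \<circ> E) (B k) $$ (r, s) = (\<Sum>m<d\<^sup>2. ?L $$ (m, k) * F (B m) $$ (r, s))"
    if "r < d" "s < d" for r s
    unfolding comp_apply liouville_expansion[OF E jk(2)]
    by (rule linear_map_mat_sum[OF F]) (use that basis_carrier in auto)
  have "liouville d B (F \<circ> E) $$ (j, k)
      = (\<Sum>x\<in>{..<d} \<times> {..<d}. cnj (B j $$ x) * (\<Sum>m<d\<^sup>2. ?L $$ (m, k) * F (B m) $$ x))"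
    unfolding liouville_index[OF FE jk]
    by (intro sum.cong refl) (auto simp: FEx simp del: comp_apply)
  also have "\<dots> = (\<Sum>x\<in>{..<d} \<times> {..<d}. \<Sum>m<d\<^sup>2. ?L $$ (m, k) * (cnj (B j $$ x) * F (B m) $$ x))"
    by (simp add: sum_distrib_left mult_ac)
  also have "\<dots> = (\<Sum>m<d\<^sup>2. \<Sum>x\<in>{..<d} \<times> {..<d}. ?L $$ (m, k) * (cnj (B j $$ x) * F (B m) $$ x))"
    by (rule sum.swap)
  also have "\<dots> = (\<Sum>m<d\<^sup>2. liouville d B F $$ (j, m) * ?L $$ (m, k))"
    using jk by (intro sum.cong refl) (simp add: sum_distrib_left[symmetric] liouville_index[OF F])
  finally show ?thesis .
qed

text \<open>Bessel's inequality is used twice: on the output side for each fixed \<open>k\<close>,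
  and on the input side for each fixed entry \<open>x\<close>, where the basis elements are replaced
  by matrix units.\<close>

lemma liouville_frobenius_le:
  assumes E: "quantum_channel d E"
  shows "(\<Sum>k<d\<^sup>2. \<Sum>j<d\<^sup>2. (cmod (liouville d B E $$ (j, k)))\<^sup>2) \<le> (real d)\<^sup>2"
proof -
  have lin: "linear_map_mat d E" using E by (simp add: quantum_channel_def)
  let ?I = "{..<d} \<times> {..<d}"
  have "(\<Sum>k<d\<^sup>2. \<Sum>j<d\<^sup>2. (cmod (liouville d B E $$ (j, k)))\<^sup>2)
      \<le> (\<Sum>k<d\<^sup>2. \<Sum>x\<in>?I. (cmod (E (B k) $$ x))\<^sup>2)"
  proof (rule sum_mono)
    fix k assume k: "k \<in> {..<d\<^sup>2}"
    show "(\<Sum>j<d\<^sup>2. (cmod (liouville d B E $$ (j, k)))\<^sup>2) \<le> (\<Sum>x\<in>?I. (cmod (E (B k) $$ x))\<^sup>2)"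
      using bessel_inequality_sum[of "d\<^sup>2" "\<lambda>k x. B k $$ x" ?I "\<lambda>x. E (B k) $$ x"]
        basis_orthonormal k
      by (simp add: liouville_index[OF lin])
  qed
  also have "\<dots> = (\<Sum>x\<in>?I. \<Sum>k<d\<^sup>2. (cmod (E (B k) $$ x))\<^sup>2)" by (rule sum.swap)
  also have "\<dots> \<le> (\<Sum>x\<in>?I. \<Sum>(a, b)\<in>?I. (cmod (E (elem_mat d a b) $$ x))\<^sup>2)"
  proof (rule sum_mono)
    fix x assume x: "x \<in> ?I"
    \<comment> \<open>The expansion over matrix units pairs with \<open>B k\<close> without
      conjugation. Conjugating it produces the form needed for Bessel and keeps the modulus.\<close>
    let ?y = "\<lambda>(a, b). cnj (E (elem_mat d a b) $$ x)"
    have "cmod (E (B k) $$ x) = cmod (\<Sum>p\<in>?I. cnj (B k $$ p) * ?y p)" if "k < d\<^sup>2" for k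
    proof -
      have "E (B k) $$ x = cnj (\<Sum>p\<in>?I. cnj (B k $$ p) * ?y p)"
        using linear_map_mat_expand[OF lin basis_carrier[OF that], of "fst x" "snd x"] x
        by (auto simp: case_prod_beta)
      then show ?thesis by (simp only: complex_mod_cnj)
    qed
    then show "(\<Sum>k<d\<^sup>2. (cmod (E (B k) $$ x))\<^sup>2) \<le> (\<Sum>(a, b)\<in>?I. (cmod (E (elem_mat d a b) $$ x))\<^sup>2)"
      using bessel_inequality_sum[of "d\<^sup>2" "\<lambda>k x. B k $$ x" ?I ?y] basis_orthonormal
      by (simp add: case_prod_beta)
  qed
  also have "\<dots> \<le> (real d)\<^sup>2"
    using channel_elem_mat_sum_le[OF E] by (simp add: case_prod_beta)
  finally show ?thesis .
qed

text \<open>Indexing by pairs makes the unital block a real vector, ready for the real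
  Cauchy-Schwarz inequality. For a channel, taking \<open>Re\<close> loses nothing.\<close>

definition ublock :: "(complex mat \<Rightarrow> complex mat) \<Rightarrow> nat \<times> nat \<Rightarrow> real" where
  "ublock E = (\<lambda>(j, k). Re (liouville d B E $$ (Suc j, Suc k)))"

lemma unital_block_index:
  assumes "quantum_channel d E" "j < d\<^sup>2 - 1" "k < d\<^sup>2 - 1"
  shows "unital_block d B E $$ (j, k) = of_real (ublock E (j, k))"
  using assms liouville_real[OF assms(1), of "Suc j" "Suc k"] square_pred(1)[OF d2]
  by (simp add: unital_block_def ublock_def complex_eq_iff)

lemma unitarity_eq:
  assumes E: "quantum_channel d E"
  shows "unitarity d B E = (\<Sum>x\<in>{..<d\<^sup>2 - 1} \<times> {..<d\<^sup>2 - 1}. (ublock E x)\<^sup>2) / ((real d)\<^sup>2 - 1)"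
proof -
  have U: "unital_block d B E \<in> carrier_mat (d\<^sup>2 - 1) (d\<^sup>2 - 1)" by (simp add: unital_block_def)
  have "mat_trace (mat_adjoint (unital_block d B E) * unital_block d B E)
      = of_real (\<Sum>x\<in>{..<d\<^sup>2 - 1} \<times> {..<d\<^sup>2 - 1}. (ublock E x)\<^sup>2)"
    unfolding mat_trace_adjoint_mult[OF U U] of_real_sum
    by (intro sum.cong refl) (auto simp: unital_block_index[OF E] power2_eq_square)
  then show ?thesis by (simp add: unitarity_def)
qed

lemma depol_const_eq:
  "depol_const d B E = (\<Sum>j<d\<^sup>2 - 1. ublock E (j, j)) / ((real d)\<^sup>2 - 1)"
  by (simp add: depol_const_def mat_trace_def unital_block_def ublock_def)

lemma depol_const_comp_eq:
  assumes F: "quantum_channel d F" and E: "quantum_channel d E"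
  shows "depol_const d B (F \<circ> E)
    = (\<Sum>(j, k)\<in>{..<d\<^sup>2 - 1} \<times> {..<d\<^sup>2 - 1}. ublock F (k, j) * ublock E (j, k)) / ((real d)\<^sup>2 - 1)"
proof -
  have lin: "linear_map_mat d F" "linear_map_mat d E" using E F by (auto simp: quantum_channel_def)
  have "ublock (F \<circ> E) (k, k) = (\<Sum>j<d\<^sup>2 - 1. ublock F (k, j) * ublock E (j, k))" if k: "k < d\<^sup>2 - 1" for k
  proof -
    have sk: "Suc k < d\<^sup>2" using k by simp
    have "ublock (F \<circ> E) (k, k)
        = Re (\<Sum>m<Suc (d\<^sup>2 - 1). liouville d B F $$ (Suc k, m) * liouville d B E $$ (m, Suc k))"
      using liouville_comp[OF lin sk sk] square_pred(1)[OF d2] by (simp add: ublock_def)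
    \<comment> \<open>The term \<open>m = 0\<close> vanishes because row 0 of the Liouville matrix
      of \<open>E\<close> is zero in column \<open>Suc k\<close>. Hence the unital block of the
      composition is the product of the unital blocks.\<close>
    also have "\<dots> = Re (\<Sum>j<d\<^sup>2 - 1. liouville d B F $$ (Suc k, Suc j) * liouville d B E $$ (Suc j, Suc k))"
      unfolding sum.lessThan_Suc_shift using liouville_row_zero[OF E sk] by simp
    also have "\<dots> = (\<Sum>j<d\<^sup>2 - 1. ublock F (k, j) * ublock E (j, k))"
      unfolding Re_sum using sk
      by (intro sum.cong refl) (auto simp: ublock_def liouville_real[OF F] liouville_real[OF E])
    finally show ?thesis .
  qed
  then have "(\<Sum>k<d\<^sup>2 - 1. ublock (F \<circ> E) (k, k))
      = (\<Sum>k<d\<^sup>2 - 1. \<Sum>j<d\<^sup>2 - 1. ublock F (k, j) * ublock E (j, k))" by simp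
  also have "\<dots> = (\<Sum>j<d\<^sup>2 - 1. \<Sum>k<d\<^sup>2 - 1. ublock F (k, j) * ublock E (j, k))" by (rule sum.swap)
  finally show ?thesis by (simp add: depol_const_eq sum.cartesian_product)
qed

lemma unitarity_le_one:
  assumes E: "quantum_channel d E"
  shows "unitarity d B E \<le> 1"
proof -
  let ?N = "d\<^sup>2 - 1" and ?L = "\<lambda>j k. (cmod (liouville d B E $$ (j, k)))\<^sup>2"
  have "(\<Sum>x\<in>{..<?N} \<times> {..<?N}. (ublock E x)\<^sup>2) = (\<Sum>j<?N. \<Sum>k<?N. (ublock E (j, k))\<^sup>2)"
    by (simp add: sum.cartesian_product)
  also have "\<dots> \<le> (\<Sum>j<?N. \<Sum>k<?N. ?L (Suc j) (Suc k))"
    unfolding ublock_def prod.case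
    by (intro sum_mono) (simp add: cmod_power2)
  also have "\<dots> = (\<Sum>k<?N. \<Sum>j<?N. ?L (Suc j) (Suc k))" by (rule sum.swap)
  \<comment> \<open>Row 0 is added to the columns of positive index.\<close>
  also have "\<dots> \<le> (\<Sum>k<?N. \<Sum>j<Suc ?N. ?L j (Suc k))"
    unfolding sum.lessThan_Suc_shift by (intro sum_mono) simp
  \<comment> \<open>Column 0 is added; its corner entry alone contributes 1, which pays for the
    subtraction.\<close>
  also have "\<dots> \<le> (\<Sum>k<Suc ?N. \<Sum>j<Suc ?N. ?L j k) - 1"
  proof -
    have "1 \<le> (\<Sum>j<Suc ?N. ?L j 0)"
      unfolding sum.lessThan_Suc_shift using liouville_row_zero[OF E, of 0] d2
      by (simp add: sum_nonneg)
    then show ?thesis by (subst (2) sum.lessThan_Suc_shift) simp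
  qed
  also have "\<dots> \<le> (real d)\<^sup>2 - 1"
    using liouville_frobenius_le[OF E] square_pred(1)[OF d2] by simp
  finally show ?thesis unfolding unitarity_eq[OF E] using square_pred[OF d2] by simp
qed

end

section \<open>Cauchy-Schwarz orthogonally to a vector, and the final inequality\<close>

text \<open>Subtracting from \<open>a\<close> and \<open>b\<close> their projections onto
  \<open>m\<close> leaves vectors whose inner product is the expression inside the absolute value
  and whose squared lengths are at most the radicands on the right.\<close>

lemma Cauchy_Schwarz_orthogonal_complement:
  fixes a b m :: "'a \<Rightarrow> real"
  assumes "(\<Sum>x\<in>I. (m x)\<^sup>2) = u" "u > 0"
    and a: "(\<Sum>x\<in>I. (a x)\<^sup>2) \<le> c" and b: "(\<Sum>x\<in>I. (b x)\<^sup>2) \<le> c"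
    and am: "(\<Sum>x\<in>I. a x * m x) = p" and bm: "(\<Sum>x\<in>I. b x * m x) = q"
  shows "\<bar>(\<Sum>x\<in>I. a x * b x) - q * p / u\<bar> \<le> sqrt (c - p\<^sup>2 / u) * sqrt (c - q\<^sup>2 / u)"
proof -
  \<comment> \<open>One identity serves both purposes: \<open>f\<close> and \<open>g\<close>
    distinct for the mixed product, \<open>f = g\<close> for the squared lengths.\<close>
  have ex: "(\<Sum>x\<in>I. (f x - s / u * m x) * (g x - t / u * m x)) = (\<Sum>x\<in>I. f x * g x) - s * t / u"
    if "(\<Sum>x\<in>I. f x * m x) = s" "(\<Sum>x\<in>I. g x * m x) = t" for f g s t
  proof -
    have "(\<Sum>x\<in>I. (f x - s / u * m x) * (g x - t / u * m x))
        = (\<Sum>x\<in>I. f x * g x - t / u * (f x * m x) - s / u * (g x * m x) + s * t / u\<^sup>2 * (m x)\<^sup>2)"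
      by (intro sum.cong refl) (simp add: algebra_simps power2_eq_square)
    also have "\<dots> = (\<Sum>x\<in>I. f x * g x) - t / u * s - s / u * t + s * t / u\<^sup>2 * u"
      using assms(1) that by (simp add: sum.distrib sum_subtractf sum_distrib_left[symmetric] del: times_divide_eq_left)
    also have "\<dots> = (\<Sum>x\<in>I. f x * g x) - s * t / u"
      using assms(2) by (simp add: field_simps power2_eq_square)
    finally show ?thesis .
  qed
  let ?a = "\<lambda>x. a x - p / u * m x" and ?b = "\<lambda>x. b x - q / u * m x"
  have "((\<Sum>x\<in>I. a x * b x) - p * q / u)\<^sup>2 \<le> (\<Sum>x\<in>I. (?a x)\<^sup>2) * (\<Sum>x\<in>I. (?b x)\<^sup>2)"
    using Cauchy_Schwarz_ineq_sum[of ?a ?b I] unfolding ex[OF am bm] .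
  also have "\<dots> \<le> (c - p\<^sup>2 / u) * (c - q\<^sup>2 / u)"
  proof (rule mult_mono)
    show *: "(\<Sum>x\<in>I. (?a x)\<^sup>2) \<le> c - p\<^sup>2 / u" "(\<Sum>x\<in>I. (?b x)\<^sup>2) \<le> c - q\<^sup>2 / u"
      using ex[OF am am] ex[OF bm bm] a b by (simp_all add: power2_eq_square)
    show "0 \<le> (\<Sum>x\<in>I. (?b x)\<^sup>2)" by (simp add: sum_nonneg)
    \<comment> \<open>The radicand dominates a squared length and is therefore nonnegative, as
      multiplying the two bounds requires.\<close>
    have "0 \<le> (\<Sum>x\<in>I. (?a x)\<^sup>2)" by (simp add: sum_nonneg)
    then show "0 \<le> c - p\<^sup>2 / u" using *(1) by linarith
  qed
  finally have "sqrt (((\<Sum>x\<in>I. a x * b x) - p * q / u)\<^sup>2) \<le> sqrt ((c - p\<^sup>2 / u) * (c - q\<^sup>2 / u))"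
    by (rule real_sqrt_le_mono)
  then show ?thesis by (simp add: real_sqrt_mult mult.commute)
qed

theorem corollary6:
  fixes d :: nat
    and B :: "nat \<Rightarrow> complex mat"
    and E\<^sub>h E :: "complex mat \<Rightarrow> complex mat"
  assumes "2 \<le> d"
    and "hermitian_orthonormal_basis d B"
    and "quantum_channel d E\<^sub>h"
    and "quantum_channel d E"
    and "unitarity d B E > 0"
  shows "\<bar>depol_const d B E\<^sub>h
            - depol_const d B (E\<^sub>h \<circ> E) * depol_const d B E / unitarity d B E\<bar>
         \<le> sqrt (1 - (depol_const d B E)\<^sup>2 / unitarity d B E)
            * sqrt (1 - (depol_const d B (E\<^sub>h \<circ> E))\<^sup>2 / unitarity d B E)"
proof -
  note db = assms(1,2) and Eh = assms(3) and E = assms(4) and u = assms(5)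
  let ?D = "(real d)\<^sup>2 - 1" and ?I = "{..<d\<^sup>2 - 1} \<times> {..<d\<^sup>2 - 1}"
  \<comment> \<open>Dividing each vector by \<open>r\<close> puts the normalisation by
    \<open>?D\<close> into every product of two of them.\<close>
  define r where "r = sqrt ?D"
  have rr: "r * r = ?D" "r\<^sup>2 = ?D" "r \<noteq> 0" using square_pred[OF db(1)] by (auto simp: r_def)
  \<comment> \<open>The three vectors are the identity, the transposed unital block of
    \<open>E\<^sub>h\<close> and the unital block of \<open>E\<close>, each divided by
    \<open>r\<close>.\<close>
  define a where "a = (\<lambda>(j::nat, k). of_bool (j = k) / r :: real)"
  define b where "b = (\<lambda>(j, k). ublock d B E\<^sub>h (k, j) / r)"
  define m where "m = (\<lambda>x. ublock d B E x / r)"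
  have diag: "(\<Sum>(j, k)\<in>?I. of_bool (j = k) * f j k) = (\<Sum>j<d\<^sup>2 - 1. f j j)" for f :: "nat \<Rightarrow> nat \<Rightarrow> real"
    by (simp add: sum.cartesian_product[symmetric] of_bool_def if_distrib[of "\<lambda>x. x * _"] cong: if_cong)
  have "(\<Sum>x\<in>?I. (m x)\<^sup>2) = unitarity d B E"
    by (simp add: m_def unitarity_eq[OF db E] power_divide rr sum_divide_distrib)
  moreover have "(\<Sum>x\<in>?I. (a x)\<^sup>2) \<le> 1"
  proof -
    have "(\<Sum>x\<in>?I. (a x)\<^sup>2) = (\<Sum>(j, k)\<in>?I. of_bool (j = k) * (1 / ?D))"
      by (intro sum.cong refl) (auto simp: a_def power_divide rr)
    also have "\<dots> = 1" unfolding diag using square_pred[OF db(1)] by simp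
    finally show ?thesis by simp
  qed
  moreover have "(\<Sum>x\<in>?I. (b x)\<^sup>2) \<le> 1"
  proof -
    have "(\<Sum>x\<in>?I. (b x)\<^sup>2) = (\<Sum>j<d\<^sup>2 - 1. \<Sum>k<d\<^sup>2 - 1. (ublock d B E\<^sub>h (k, j))\<^sup>2 / ?D)"
      by (simp add: sum.cartesian_product b_def case_prod_beta power_divide rr)
    \<comment> \<open>Exchanging the sums undoes the transposition, which does not change the
      Frobenius norm.\<close>
    also have "\<dots> = (\<Sum>k<d\<^sup>2 - 1. \<Sum>j<d\<^sup>2 - 1. (ublock d B E\<^sub>h (k, j))\<^sup>2 / ?D)" by (rule sum.swap)
    also have "\<dots> = unitarity d B E\<^sub>h"
      by (simp add: unitarity_eq[OF db Eh] sum.cartesian_product sum_divide_distrib)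
    finally show ?thesis using unitarity_le_one[OF db Eh] by simp
  qed
  moreover have "(\<Sum>x\<in>?I. a x * m x) = depol_const d B E"
  proof -
    have "(\<Sum>x\<in>?I. a x * m x) = (\<Sum>(j, k)\<in>?I. of_bool (j = k) * (ublock d B E (j, k) / ?D))"
      by (intro sum.cong refl) (auto simp: a_def m_def rr)
    then show ?thesis unfolding diag by (simp add: depol_const_eq[OF db] sum_divide_distrib)
  qed
  moreover have "(\<Sum>x\<in>?I. b x * m x) = depol_const d B (E\<^sub>h \<circ> E)"
    by (simp add: b_def m_def depol_const_comp_eq[OF db Eh E] case_prod_beta rr sum_divide_distrib)
  moreover have "(\<Sum>x\<in>?I. a x * b x) = depol_const d B E\<^sub>h"
  proof -
    have "(\<Sum>x\<in>?I. a x * b x) = (\<Sum>(j, k)\<in>?I. of_bool (j = k) * (ublock d B E\<^sub>h (k, j) / ?D))"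
      by (intro sum.cong refl) (auto simp: a_def b_def rr)
    then show ?thesis unfolding diag by (simp add: depol_const_eq[OF db] sum_divide_distrib)
  qed
  ultimately show ?thesis
    using Cauchy_Schwarz_orthogonal_complement[of m ?I "unitarity d B E" a 1 b] u by metis
qed

end
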